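(* Let $r$ and $s$ be relatively prime positive integers such that $1 \leq r < s$ and $r$ divides $s-1$. Let $d = (s-1)/r$. The polynomials \[ F_{r/s}(x,y) = \frac{r(x-dy)^2}{2} + \frac{(2-r)x + (dr-2d+2)y}{2} \] and \[ G_{r/s}(x,y) = \frac{r(x-dy)^2}{2} + \frac{(r+2)x - (2d+s+1)y}{2} \] are quadratic packing polynomials for the integer sector $I(r/s) = \{(x,y)\in\mathbf{N}_0^2 : 0 \leq y \leq rx/s\}$; that is, each is a polynomial of degree two that restricts to a bijection from $I(r/s)$ onto $\mathbf{N}_0$.
   Context: $\mathbf{N}_0$ denotes the set of nonnegative integers. A packing polynomial on an integer sector $I \subseteq \mathbf{N}_0^2$ is a polynomial in two variables (with real coefficients) whose restriction to $I$ is a one-to-one correspondence between $I$ and $\mathbf{N}_0$. Quadratic means of total degree two. *)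

theory Defs
  imports Complex_Main "HOL-Computational_Algebra.Polynomial"
begin

text \<open>Polynomials in two variables \<open>x\<close>, \<open>y\<close> over the reals are represented as
  \<^typ>\<open>real poly poly\<close>, read as polynomials in \<open>y\<close> with coefficients in \<open>\<real>[x]\<close>:
  \<open>coeff (coeff p j) i\<close> is the coefficient of \<open>x\<^sup>i y\<^sup>j\<close>.\<close>

definition const2 :: "real \<Rightarrow> real poly poly" where
  "const2 c = [:[:c:]:]"

definition varX :: "real poly poly" where
  "varX = [:[:0, 1:]:]"

definition varY :: "real poly poly" where
  "varY = [:0, 1:]"

definition eval2 :: "real poly poly \<Rightarrow> real \<Rightarrow> real \<Rightarrow> real" where
  "eval2 p x y = poly (poly p [:y:]) x"

lemma eval2_simps [simp]:
  "eval2 (const2 c) x y = c"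
  "eval2 varX x y = x"
  "eval2 varY x y = y"
  "eval2 (p + q) x y = eval2 p x y + eval2 q x y"
  "eval2 (p - q) x y = eval2 p x y - eval2 q x y"
  "eval2 (p * q) x y = eval2 p x y * eval2 q x y"
  "eval2 (p ^ n) x y = eval2 p x y ^ n"
  by (simp_all add: eval2_def const2_def varX_def varY_def poly_power)

text \<open>The inserted \<open>0\<close> only matters for the zero polynomial, whose total degree is set to \<open>0\<close>.\<close>

definition total_degree :: "real poly poly \<Rightarrow> nat" where
  "total_degree p = Max (insert 0 {i + j | i j. coeff (coeff p j) i \<noteq> 0})"

lemma finite_total_degree_set:
  "finite {i + j | i j. coeff (coeff (p :: real poly poly) j) i \<noteq> 0}"
proof (rule finite_subset)
  show "{i + j | i j. coeff (coeff p j) i \<noteq> 0}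
      \<subseteq> (\<Union>j\<in>{..degree p}. (\<lambda>i. i + j) ` {..degree (coeff p j)})"
  proof
    fix n assume "n \<in> {i + j | i j. coeff (coeff p j) i \<noteq> 0}"
    then obtain i j where n: "n = i + j" and c: "coeff (coeff p j) i \<noteq> 0"
      by blast
    have "i \<le> degree (coeff p j)"
      using c by (rule le_degree)
    moreover have "j \<le> degree p"
      using c by (intro le_degree) auto
    ultimately show "n \<in> (\<Union>j\<in>{..degree p}. (\<lambda>i. i + j) ` {..degree (coeff p j)})"
      using n by auto
  qed
qed simp

definition sector :: "real \<Rightarrow> (nat \<times> nat) set" where
  "sector \<alpha> = {(x, y). 0 \<le> real y \<and> real y \<le> \<alpha> * real x}"

text \<open>\<open>\<nat>\<close> is the set of nonnegative integers inside the reals, so integrality of the values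
  on \<open>S\<close> is part of the condition.\<close>

definition packing_polynomial_on :: "(nat \<times> nat) set \<Rightarrow> real poly poly \<Rightarrow> bool" where
  "packing_polynomial_on S p \<longleftrightarrow>
     bij_betw (\<lambda>(x, y). eval2 p (real x) (real y)) S (\<nat> :: real set)"

definition quadratic_packing_polynomial_on :: "(nat \<times> nat) set \<Rightarrow> real poly poly \<Rightarrow> bool" where
  "quadratic_packing_polynomial_on S p \<longleftrightarrow> total_degree p = 2 \<and> packing_polynomial_on S p"

definition F_poly :: "nat \<Rightarrow> nat \<Rightarrow> real poly poly" where
  "F_poly r s =
    (let d = (real s - 1) / real r in
       const2 (real r / 2) * (varX - const2 d * varY) ^ 2
     + const2 (1 / 2) * (const2 (2 - real r) * varX + const2 (d * real r - 2 * d + 2) * varY))"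

definition G_poly :: "nat \<Rightarrow> nat \<Rightarrow> real poly poly" where
  "G_poly r s =
    (let d = (real s - 1) / real r in
       const2 (real r / 2) * (varX - const2 d * varY) ^ 2
     + const2 (1 / 2) * (const2 (real r + 2) * varX - const2 (2 * d + real s + 1) * varY))"

lemma eval2_F_poly:
  assumes "d = (real s - 1) / real r"
  shows "eval2 (F_poly r s) x y =
    real r * (x - d * y)\<^sup>2 / 2 + ((2 - real r) * x + (d * real r - 2 * d + 2) * y) / 2"
  by (simp only: F_poly_def Let_def assms eval2_simps) simp

lemma eval2_G_poly:
  assumes "d = (real s - 1) / real r"
  shows "eval2 (G_poly r s) x y =
    real r * (x - d * y)\<^sup>2 / 2 + ((real r + 2) * x - (2 * d + real s + 1) * y) / 2"
  by (simp only: G_poly_def Let_def assms eval2_simps) simp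

end

theory Submission
  imports Defs
begin

text \<open>Since \<open>s = r d + 1\<close>, the shear \<open>u = x - d y\<close> carries the sector onto the set of all
  \<open>(u, y)\<close> with \<open>y \<le> r u\<close>, and \<open>F\<close> becomes \<open>r u (u - 1) / 2 + u + y\<close>. It enumerates the rows
  \<open>u = 0, 1, 2, \<dots>\<close> one after the other, since row \<open>u\<close> has \<open>r u + 1\<close> points. In the same
  coordinates \<open>G(u, y) = F(u, r u - y)\<close>, which runs through each row backwards.\<close>

text \<open>The half-open intervals from \<open>T u\<close> to \<open>T (Suc u)\<close> tile the
  naturals: they start at 0, none is empty, and each begins where the previous one stops.\<close>

lemma bij_betw_concat_intervals:
  fixes T :: "nat \<Rightarrow> nat"
  assumes "strict_mono T" and "T 0 = 0"
  shows "bij_betw (\<lambda>(u, k). T u + k) (SIGMA u:UNIV. {k. T u + k < T (Suc u)}) UNIV"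
proof -
  have le: "u \<le> v" if "T u + k = T v + l" "T v + l < T (Suc v)" for u v k l
  proof -
    have "T u < T (Suc v)" using that by linarith
    then show ?thesis using strict_mono_less[OF assms(1)] by simp
  qed
  have rows: "\<exists>u k. n = T u + k \<and> T u + k < T (Suc u)" for n
  proof (induction n)
    case 0
    have "T 0 < T (Suc 0)" using assms(1) by (simp add: strict_monoD)
    then show ?case using assms(2) by force
  next
    case (Suc n)
    then obtain u k where n: "n = T u + k" "T u + k < T (Suc u)" by blast
    show ?case
    proof (cases "Suc n < T (Suc u)")
      case True
      then show ?thesis using n by (intro exI[of _ u] exI[of _ "Suc k"]) simp
    next
      case False
      \<comment> \<open>Here \<open>Suc n\<close> is exactly \<open>T (Suc u)\<close>; strictness
        puts it at offset 0 of the next, nonempty interval.\<close>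
      have "T (Suc u) < T (Suc (Suc u))" using assms(1) by (simp add: strict_monoD)
      then show ?thesis using n False
        by (intro exI[of _ "Suc u"] exI[of _ 0]) simp
    qed
  qed
  have "n \<in> (\<lambda>(u, k). T u + k) ` (SIGMA u:UNIV. {k. T u + k < T (Suc u)})" for n
  proof -
    obtain u k where "n = T u + k" "T u + k < T (Suc u)" using rows by blast
    then show ?thesis by (intro image_eqI[of _ _ "(u, k)"]) simp_all
  qed
  then have "(\<lambda>(u, k). T u + k) ` (SIGMA u:UNIV. {k. T u + k < T (Suc u)}) = UNIV"
    by blast
  moreover have "inj_on (\<lambda>(u, k). T u + k) (SIGMA u:UNIV. {k. T u + k < T (Suc u)})"
  proof (rule inj_onI)
    fix p q
    assume *: "p \<in> (SIGMA u:UNIV. {k. T u + k < T (Suc u)})"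
      "q \<in> (SIGMA u:UNIV. {k. T u + k < T (Suc u)})"
      "(case p of (u, k) \<Rightarrow> T u + k) = (case q of (u, k) \<Rightarrow> T u + k)"
    obtain u k v l where pq: "p = (u, k)" "q = (v, l)" by (metis surj_pair)
    then have "T u + k = T v + l" "T u + k < T (Suc u)" "T v + l < T (Suc v)"
      using * by simp_all
    moreover from this have "u = v" using le[of u k v l] le[of v l u k] by simp
    ultimately show "p = q" using pq by simp
  qed
  ultimately show ?thesis by (simp add: bij_betw_def)
qed

text \<open>This is the total length of rows 0 to u - 1, row v having \<open>r * v + 1\<close>
  points. The binomial coefficient keeps it in the naturals without a division.\<close>

definition row_start :: "nat \<Rightarrow> nat \<Rightarrow> nat" where
  "row_start r u = r * (u choose 2) + u"

lemma row_start_Suc: "row_start r (Suc u) = row_start r u + (r * u + 1)"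
  by (simp add: row_start_def numeral_2_eq_2 algebra_simps)

lemma of_nat_row_start: "real (row_start r u) = real r * real u * (real u - 1) / 2 + real u"
proof (induction u)
  case 0
  show ?case by (simp add: row_start_def)
next
  case (Suc u)
  then show ?case by (simp add: row_start_Suc algebra_simps add_divide_distrib diff_divide_distrib)
qed

lemma bij_betw_rows: "bij_betw (\<lambda>(u, y). row_start r u + y) (SIGMA u:UNIV. {..r * u}) UNIV"
proof -
  have "strict_mono (row_start r)" by (simp add: strict_mono_Suc_iff row_start_Suc)
  moreover have "row_start r 0 = 0" by (simp add: row_start_def)
  moreover have "(SIGMA u:UNIV. {k. row_start r u + k < row_start r (Suc u)}) =
      (SIGMA u:UNIV. {..r * u})"
    by (auto simp: row_start_Suc)
  ultimately show ?thesis using bij_betw_concat_intervals[of "row_start r"] by simp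
qed

text \<open>Reversal is its own inverse: the bound \<open>y \<le> r * u\<close> makes both truncated
  subtractions exact.\<close>

lemma bij_betw_reverse_rows:
  fixes r :: nat
  shows "bij_betw (\<lambda>(u, y). (u, r * u - y)) (SIGMA u:UNIV. {..r * u}) (SIGMA u:UNIV. {..r * u})"
  by (rule bij_betw_byWitness[where f' = "\<lambda>(u, y). (u, r * u - y)"]) auto

lemma sector_eq:
  assumes "0 < s"
  shows "sector (real r / real s) = {(x, y). s * y \<le> r * x}"
proof -
  have "(x, y) \<in> sector (real r / real s) \<longleftrightarrow> real (s * y) \<le> real (r * x)" for x y
    using assms by (simp add: sector_def field_simps)
  then show ?thesis by (auto simp only: of_nat_le_iff)
qed

text \<open>Putting x = d y + u cancels r d y on both sides and leaves y \<le> r u.\<close>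

lemma sheared_inequality:
  fixes r d x y :: nat
  assumes "0 < r"
  shows "(r * d + 1) * y \<le> r * x \<longleftrightarrow> d * y \<le> x \<and> y \<le> r * (x - d * y)"
proof
  assume *: "(r * d + 1) * y \<le> r * x"
  have "r * (d * y) \<le> (r * d + 1) * y" by simp
  then have "r * (d * y) \<le> r * x" using * by (rule order_trans)
  then have "d * y \<le> x" using assms by simp
  moreover have "y \<le> r * (x - d * y)" using * by (simp add: algebra_simps)
  ultimately show "d * y \<le> x \<and> y \<le> r * (x - d * y)" ..
next
  assume *: "d * y \<le> x \<and> y \<le> r * (x - d * y)"
  then obtain u where "x = d * y + u" by (auto simp: le_iff_add)
  then show "(r * d + 1) * y \<le> r * x" using * by (simp add: algebra_simps)
qed

lemma bij_betw_shear:
  fixes r d :: nat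
  assumes "0 < r"
  shows "bij_betw (\<lambda>(x, y). (x - d * y, y)) {(x, y). (r * d + 1) * y \<le> r * x}
    (SIGMA u:UNIV. {..r * u})"
  unfolding sheared_inequality[OF assms]
  by (rule bij_betw_byWitness[where f' = "\<lambda>(u, y). (u + d * y, y)"]) auto

lemma packing_polynomial_onI:
  assumes "bij_betw f S (UNIV :: nat set)"
    and "\<And>x y. (x, y) \<in> S \<Longrightarrow> eval2 p (real x) (real y) = real (f (x, y))"
  shows "packing_polynomial_on S p"
proof -
  have "bij_betw real UNIV (\<nat> :: real set)"
    by (simp add: bij_betw_def Nats_def inj_of_nat)
  then have "bij_betw (real \<circ> f) S \<nat>" using assms(1) by (rule bij_betw_trans[rotated])
  then show ?thesis unfolding packing_polynomial_on_def
    by (rule bij_betw_cong[THEN iffD1, rotated]) (auto simp: assms(2))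
qed

text \<open>The lists hold coefficients of powers of y outside and of x inside, so no monomial
  exceeds degree 2, and x^2 attains it.\<close>

lemma total_degree_eq_2:
  assumes "p = [:[:a, b, c:], [:e, f:], [:g:]:]" and "c \<noteq> 0"
  shows "total_degree p = 2"
proof -
  have le: "i + j \<le> 2" if "coeff (coeff p j) i \<noteq> 0" for i j
    using that unfolding assms(1)
    by (auto simp: coeff_pCons split: nat.splits)
  have "coeff (coeff p 0) 2 \<noteq> 0"
    using assms by (simp add: numeral_2_eq_2)
  then have "2 \<in> {i + j | i j. coeff (coeff p j) i \<noteq> 0}" by force
  then show ?thesis unfolding total_degree_def
    by (intro Max_eqI) (auto simp: finite_total_degree_set dest: le)
qed

lemma total_degree_quadratic:
  assumes "c \<noteq> 0"
  shows "total_degree (const2 c * (varX - const2 d * varY) ^ 2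
    + const2 k * (const2 a * varX + const2 b * varY)) = 2"
  \<comment> \<open>These are the coefficients of the expansion of c (x - d y)^2 + k (a x + b
    y).\<close>
  by (rule total_degree_eq_2[where a = 0 and b = "k * a" and c = c and e = "k * b"
        and f = "- 2 * c * d" and g = "c * d * d"])
    (use assms in \<open>simp_all add: const2_def varX_def varY_def power2_eq_square\<close>)

lemma total_degree_F_poly:
  assumes "0 < r"
  shows "total_degree (F_poly r s) = 2"
  unfolding F_poly_def Let_def by (rule total_degree_quadratic) (use assms in simp)

lemma total_degree_G_poly:
  assumes "0 < r"
  shows "total_degree (G_poly r s) = 2"
proof -
  have "G_poly r s = (let d = (real s - 1) / real r in
       const2 (real r / 2) * (varX - const2 d * varY) ^ 2
     + const2 (1 / 2) * (const2 (real r + 2) * varX + const2 (- (2 * d + real s + 1)) * varY))"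
    by (simp add: G_poly_def Let_def const2_def varX_def varY_def)
  also have "total_degree \<dots> = 2"
    unfolding Let_def by (rule total_degree_quadratic) (use assms in simp)
  finally show ?thesis .
qed

text \<open>At x = u + d y the square is u^2, and in the linear part the terms in d cancel, so y
  keeps coefficient 1.\<close>

lemma eval2_F_poly_shear:
  assumes "0 < r"
  shows "eval2 (F_poly r (r * d + 1)) (real (u + d * y)) (real y) = real (row_start r u + y)"
proof -
  have "real d = (real (r * d + 1) - 1) / real r" using assms by simp
  from eval2_F_poly[OF this, of "real (u + d * y)" "real y"] show ?thesis
    by (simp add: of_nat_row_start field_simps power2_eq_square)
qed

text \<open>The coefficient of y becomes (r d - s - 1) / 2, which is -1 since s = r d + 1; the u
  terms give the row start plus r u.\<close>

lemma eval2_G_poly_shear: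
  assumes "0 < r" and "y \<le> r * u"
  shows "eval2 (G_poly r (r * d + 1)) (real (u + d * y)) (real y) =
    real (row_start r u + (r * u - y))"
proof -
  have "real d = (real (r * d + 1) - 1) / real r" using assms by simp
  from eval2_G_poly[OF this, of "real (u + d * y)" "real y"] show ?thesis
    using assms(2) by (simp add: of_nat_row_start field_simps power2_eq_square)
qed

theorem theorem10:
  fixes r s :: nat
  assumes "coprime r s" and "1 \<le> r" and "r < s" and "r dvd s - 1"
  shows "quadratic_packing_polynomial_on (sector (real r / real s)) (F_poly r s) \<and>
         quadratic_packing_polynomial_on (sector (real r / real s)) (G_poly r s)"
proof -
  have r: "0 < r" using assms(2) by simp
  obtain d where "s - 1 = r * d" using assms(4) by (elim dvdE)
  \<comment> \<open>From \<open>r < s\<close>, s is positive, so the truncated \<open>s - 1\<close>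
    is a true predecessor.\<close>
  then have s: "s = r * d + 1" using assms(3) by simp
  let ?S = "sector (real r / real s)"
  let ?shear = "\<lambda>(x, y). (x - d * y, y)"
  let ?row = "\<lambda>(u, y). row_start r u + y"
  let ?rev = "\<lambda>(u, y). (u, r * u - y)"
  have shear: "bij_betw ?shear ?S (SIGMA u:UNIV. {..r * u})"
    using bij_betw_shear[OF r] sector_eq[of s r] s by simp
  \<comment> \<open>This puts sector points in the form u + d y with y \<le> r u required by the
    evaluation lemmas.\<close>
  have in_sector: "x = (x - d * y) + d * y \<and> y \<le> r * (x - d * y)" if "(x, y) \<in> ?S" for x y
    using that sheared_inequality[OF r, of d y x] sector_eq[of s r] s by simp
  have "packing_polynomial_on ?S (F_poly r s)"
  proof (rule packing_polynomial_onI)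
    show "bij_betw (?row \<circ> ?shear) ?S UNIV"
      using shear bij_betw_rows by (rule bij_betw_trans)
    show "eval2 (F_poly r s) (real x) (real y) = real ((?row \<circ> ?shear) (x, y))"
      if "(x, y) \<in> ?S" for x y
      using eval2_F_poly_shear[OF r, of d "x - d * y" y] in_sector[OF that] s by simp
  qed
  moreover have "packing_polynomial_on ?S (G_poly r s)"
  proof (rule packing_polynomial_onI)
    show "bij_betw (?row \<circ> (?rev \<circ> ?shear)) ?S UNIV"
      using bij_betw_trans[OF shear bij_betw_reverse_rows] bij_betw_rows by (rule bij_betw_trans)
    show "eval2 (G_poly r s) (real x) (real y) = real ((?row \<circ> (?rev \<circ> ?shear)) (x, y))"
      if "(x, y) \<in> ?S" for x y
      using eval2_G_poly_shear[OF r, of y "x - d * y" d] in_sector[OF that] s by simp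
  qed
  ultimately show ?thesis
    by (simp add: quadratic_packing_polynomial_on_def total_degree_F_poly total_degree_G_poly r)
qed

end
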